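(* Let $G$ be a finite group and $H$ a subgroup of index $[G:H]=k+1$ with $k\geq 1$. Let $S\subset G$ be a nonempty subset with $S_H=S\cap H$ symmetric and $|S_O|\neq 0$, where $S_O=S\setminus H$. Let $e=x_0,x_1,\ldots,x_k$ be representatives of the right cosets of $H$ in $G$ and set $S_i=S\cap Hx_i$ for $i\in\{1,\ldots,k\}$. Then \[\mu^{\pm}=\frac{|S_H|\pm\sqrt{|S_H|^2+4\sum_{i=1}^k |S_i|^2}}{2}\] are eigenvalues of $\mathcal{G}(G,H,S)$, and a corresponding eigenfunction $f^{\pm}$ is given by $f^{\pm}(y)=\mu^{\pm}$ for $y\in H$ and $f^{\pm}(y)=|S_i|$ for $y\in Hx_i$, $i\in\{1,\ldots,k\}$.
   Context: A subset $X\subset G$ is symmetric if $X^{-1}=X$. The group-subgroup pair graph $\mathcal{G}(G,H,S)$ is the undirected graph with vertex set $G$ whose edges are exactly the pairs $\{h,hs\}$ with $h\in H$, $s\in S$. Its eigenvalues and eigenfunctions are those of the adjacency operator on functions $f:G\to\mathbb{C}$, $(Af)(x)=\sum_{y\sim x}f(y)$; explicitly $(Af)(y)=\sum_{s\in S}f(ys)$ for $y\in H$ and $(Af)(y)=\sum_{s\in S\cap Hy} f(ys^{-1})$ for $y\in G\setminus H$. *)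

theory Defs
  imports Complex_Main "HOL-Algebra.Coset"
begin

text \<open>
  Graphs are given by a set of edges, each edge being an unordered pair \<open>{x, y}\<close>.
  A singleton edge \<open>{x}\<close> is a loop at \<open>x\<close> (it occurs here iff \<open>x \<in> H\<close> and \<open>\<one> \<in> S\<close>), and it
  contributes \<open>f x\<close> once to the adjacency operator.
\<close>

definition pair_graph_edges ::
    "('a, 'b) monoid_scheme \<Rightarrow> 'a set \<Rightarrow> 'a set \<Rightarrow> 'a set set" where
  "pair_graph_edges G H S = {{h, h \<otimes>\<^bsub>G\<^esub> s} | h s. h \<in> H \<and> s \<in> S}"

definition adjacency_op :: "'a set \<Rightarrow> 'a set set \<Rightarrow> ('a \<Rightarrow> complex) \<Rightarrow> 'a \<Rightarrow> complex" where
  "adjacency_op V E f x = (\<Sum>y \<in> {y \<in> V. {x, y} \<in> E}. f y)"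

text \<open>Functions on \<open>V\<close> are represented by total functions whose values outside \<open>V\<close> are
  irrelevant; in particular an eigenfunction has to be nonzero somewhere on \<open>V\<close>.\<close>

definition graph_eigenfunction ::
    "'a set \<Rightarrow> 'a set set \<Rightarrow> complex \<Rightarrow> ('a \<Rightarrow> complex) \<Rightarrow> bool" where
  "graph_eigenfunction V E \<mu> f \<longleftrightarrow>
     (\<exists>x\<in>V. f x \<noteq> 0) \<and> (\<forall>x\<in>V. adjacency_op V E f x = \<mu> * f x)"

definition graph_eigenvalue :: "'a set \<Rightarrow> 'a set set \<Rightarrow> complex \<Rightarrow> bool" where
  "graph_eigenvalue V E \<mu> \<longleftrightarrow> (\<exists>f. graph_eigenfunction V E \<mu> f)"

lemma (in group) adjacency_op_pair_graph_in:
  assumes H: "subgroup H G" and S: "S \<subseteq> carrier G"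
    and sym: "set_inv (S \<inter> H) = S \<inter> H" and y: "y \<in> H"
  shows "adjacency_op (carrier G) (pair_graph_edges G H S) f y = (\<Sum>s\<in>S. f (y \<otimes> s))"
proof -
  have HG: "H \<subseteq> carrier G" using H by (rule subgroup.subset)
  have yG: "y \<in> carrier G" using y HG by auto
  have "{z \<in> carrier G. {y, z} \<in> pair_graph_edges G H S} = (\<lambda>s. y \<otimes> s) ` S"
  proof (intro equalityI subsetI)
    fix z assume "z \<in> {z \<in> carrier G. {y, z} \<in> pair_graph_edges G H S}"
    then obtain h s where hs: "h \<in> H" "s \<in> S" "{y, z} = {h, h \<otimes> s}"
      by (auto simp: pair_graph_edges_def)
    have hG: "h \<in> carrier G" and sG: "s \<in> carrier G" using hs HG S by auto
    consider "y = h" "z = h \<otimes> s" | "y = h \<otimes> s" "z = h"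
      using hs(3) by (auto simp: doubleton_eq_iff)
    then show "z \<in> (\<lambda>s. y \<otimes> s) ` S"
    proof cases
      case 1
      then show ?thesis using hs by auto
    next
      case 2
      have "s = inv h \<otimes> y" using 2 hG sG by (simp add: m_assoc[symmetric])
      then have "s \<in> H" using H y hs(1) by (simp add: subgroup.m_closed subgroup.m_inv_closed)
      then have "inv s \<in> S \<inter> H" using hs(2) sym by (auto simp: SET_INV_def)
      moreover have "z = y \<otimes> inv s" using 2 hG sG by (simp add: m_assoc)
      ultimately show ?thesis by auto
    qed
  next
    fix z assume "z \<in> (\<lambda>s. y \<otimes> s) ` S"
    then show "z \<in> {z \<in> carrier G. {y, z} \<in> pair_graph_edges G H S}"
      using yG S y by (auto simp: pair_graph_edges_def)
  qed
  moreover have "inj_on (\<lambda>s. y \<otimes> s) S"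
  proof (rule inj_onI)
    fix s t assume st: "s \<in> S" "t \<in> S" "y \<otimes> s = y \<otimes> t"
    then have "s \<in> carrier G" "t \<in> carrier G" using S by auto
    with st(3) yG show "s = t" using Units_l_cancel[of y s t] by simp
  qed
  ultimately show ?thesis by (simp add: adjacency_op_def sum.reindex)
qed

lemma (in group) adjacency_op_pair_graph_out:
  assumes H: "subgroup H G" and S: "S \<subseteq> carrier G" and y: "y \<in> carrier G - H"
  shows "adjacency_op (carrier G) (pair_graph_edges G H S) f y =
    (\<Sum>s\<in>S \<inter> (H #> y). f (y \<otimes> inv s))"
proof -
  have HG: "H \<subseteq> carrier G" using H by (rule subgroup.subset)
  have yG: "y \<in> carrier G" using y by auto
  have "{z \<in> carrier G. {y, z} \<in> pair_graph_edges G H S} = (\<lambda>s. y \<otimes> inv s) ` (S \<inter> (H #> y))"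
  proof (intro equalityI subsetI)
    fix z assume "z \<in> {z \<in> carrier G. {y, z} \<in> pair_graph_edges G H S}"
    then obtain h s where hs: "h \<in> H" "s \<in> S" "{y, z} = {h, h \<otimes> s}"
      by (auto simp: pair_graph_edges_def)
    have hG: "h \<in> carrier G" and sG: "s \<in> carrier G" using hs HG S by auto
    have yz: "y = h \<otimes> s" "z = h" using hs y by (auto simp: doubleton_eq_iff)
    have "s = inv h \<otimes> y" using yz hG sG by (simp add: m_assoc[symmetric])
    then have "s \<in> H #> y" using H hs(1) by (auto simp: r_coset_def subgroup.m_inv_closed)
    moreover have "z = y \<otimes> inv s" using yz hG sG by (simp add: m_assoc)
    ultimately show "z \<in> (\<lambda>s. y \<otimes> inv s) ` (S \<inter> (H #> y))" using hs by auto
  next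
    fix z assume "z \<in> (\<lambda>s. y \<otimes> inv s) ` (S \<inter> (H #> y))"
    then obtain s h where s: "s \<in> S" "z = y \<otimes> inv s" and h: "h \<in> H" "s = h \<otimes> y"
      by (auto simp: r_coset_def)
    have hG: "h \<in> carrier G" and sG: "s \<in> carrier G" using h s HG S by auto
    have "z = inv h" using s h hG yG by (simp add: inv_mult_group m_assoc[symmetric])
    then have "z \<in> H" using H h by (simp add: subgroup.m_inv_closed)
    moreover have "y = z \<otimes> s" using s(2) yG sG by (simp add: m_assoc)
    ultimately show "z \<in> {z \<in> carrier G. {y, z} \<in> pair_graph_edges G H S}"
      using s(1) HG by (auto simp: pair_graph_edges_def)
  qed
  moreover have "inj_on (\<lambda>s. y \<otimes> inv s) (S \<inter> (H #> y))"
  proof (rule inj_onI)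
    fix s t assume st: "s \<in> S \<inter> (H #> y)" "t \<in> S \<inter> (H #> y)" "y \<otimes> inv s = y \<otimes> inv t"
    then have sG: "s \<in> carrier G" and tG: "t \<in> carrier G" using S by auto
    have "inv s = inv t" using st(3) yG sG tG Units_l_cancel[of y "inv s" "inv t"] by simp
    then have "inv (inv s) = inv (inv t)" by (rule arg_cong)
    then show "s = t" using sG tG by simp
  qed
  ultimately show ?thesis by (simp add: adjacency_op_def sum.reindex)
qed

end

theory Submission
  imports Defs
begin

text \<open>
  Every \<open>s \<in> S \<inter> (H #> x i)\<close> carries a vertex of \<open>H\<close> into \<open>H #> x i\<close>, so functions constant on
  the right cosets are preserved by the adjacency operator. On such functions taking the value
  \<open>\<mu>\<close> on \<open>H\<close> and \<open>\<bar>S\<^sub>i\<bar>\<close> on \<open>H #> x i\<close>, the eigenvalue equation off \<open>H\<close> is automatic, and on \<open>H\<close>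
  it reads \<open>\<mu>\<^sup>2 = \<bar>S\<^sub>H\<bar> \<mu> + (\<Sum>i. \<bar>S\<^sub>i\<bar>\<^sup>2)\<close>, whose roots are the two given numbers.
\<close>

lemma (in group) pair_graph_eigenfunctionI:
  assumes H: "subgroup H G" and S: "S \<subseteq> carrier G" and fin: "finite S"
    and sym: "set_inv (S \<inter> H) = S \<inter> H" and ne: "S - H \<noteq> {}"
    and f_in: "\<And>y. y \<in> H \<Longrightarrow> f y = \<mu>"
    and f_out: "\<And>y. y \<in> carrier G - H \<Longrightarrow> f y = of_nat (card (S \<inter> (H #> y)))"
    and \<mu>: "\<mu>\<^sup>2 = of_nat (card (S \<inter> H)) * \<mu> + of_nat (\<Sum>s\<in>S - H. card (S \<inter> (H #> s)))"
  shows "graph_eigenfunction (carrier G) (pair_graph_edges G H S) \<mu> f"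
proof -
  have HG: "H \<subseteq> carrier G" using H by (rule subgroup.subset)
  \<comment> \<open>A point of \<open>S\<close> outside \<open>H\<close> witnesses that
    \<open>f\<close> is not zero: there \<open>f\<close> is the size of a set containing that point,
    so no separate argument that \<open>\<mu>\<close> is nonzero is required.\<close>
  obtain s\<^sub>0 where s\<^sub>0: "s\<^sub>0 \<in> S" "s\<^sub>0 \<notin> H" using ne by auto
  have s\<^sub>0G: "s\<^sub>0 \<in> carrier G" using s\<^sub>0 S by auto
  have "s\<^sub>0 \<in> S \<inter> (H #> s\<^sub>0)" using s\<^sub>0 rcos_self[OF s\<^sub>0G H] by simp
  then have "card (S \<inter> (H #> s\<^sub>0)) \<noteq> 0" using fin by auto
  then have "f s\<^sub>0 \<noteq> 0" using f_out s\<^sub>0 s\<^sub>0G by simp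
  moreover have "adjacency_op (carrier G) (pair_graph_edges G H S) f y = \<mu> * f y"
    if y: "y \<in> carrier G" for y
  proof (cases "y \<in> H")
    case True
    have 1: "f (y \<otimes> s) = \<mu>" if "s \<in> S \<inter> H" for s
      using that True f_in H by (simp add: subgroup.m_closed)
    \<comment> \<open>Left multiplication by \<open>y\<close> in \<open>H\<close> keeps
      \<open>s\<close> in its right coset, and off \<open>H\<close> the value of \<open>f\<close>
      depends on the coset alone.\<close>
    have 2: "f (y \<otimes> s) = of_nat (card (S \<inter> (H #> s)))" if s: "s \<in> S - H" for s
    proof -
      have sG: "s \<in> carrier G" using s S by auto
      have ys: "y \<otimes> s \<in> H #> s" using True by (auto simp: r_coset_def)
      have coset: "H #> s = H #> (y \<otimes> s)" by (rule repr_independence[OF ys sG H])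
      have "y \<otimes> s \<notin> H"
      proof
        assume "y \<otimes> s \<in> H"
        then have "H #> s = H" using coset coset_join2[OF _ H] y sG by simp
        then show False using s rcos_self[OF sG H] by simp
      qed
      then show ?thesis using f_out[of "y \<otimes> s"] y sG coset by simp
    qed
    have "(\<Sum>s\<in>S. f (y \<otimes> s)) = (\<Sum>s\<in>S \<inter> H. f (y \<otimes> s)) + (\<Sum>s\<in>S - H. f (y \<otimes> s))"
      by (rule sum.Int_Diff[OF fin])
    also have "\<dots> = \<mu>\<^sup>2" using 1 2 \<mu> by simp
    finally show ?thesis
      using adjacency_op_pair_graph_in[OF H S sym True, of f] f_in[OF True]
      by (simp add: power2_eq_square)
  next
    case False
    \<comment> \<open>Every neighbour of a vertex \<open>y\<close> outside \<open>H\<close> lies in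
      \<open>H\<close>: if \<open>s = h \<otimes> y\<close>, then
      \<open>y \<otimes> inv s = inv h\<close>. Hence the sum is \<open>\<mu>\<close> times the
      number of neighbours, which is \<open>f y\<close>.\<close>
    have "f (y \<otimes> inv s) = \<mu>" if s: "s \<in> S \<inter> (H #> y)" for s
    proof -
      obtain h where h: "h \<in> H" "s = h \<otimes> y" using s by (auto simp: r_coset_def)
      have "y \<otimes> inv s = inv h"
        using h HG y by (auto simp: inv_mult_group m_assoc[symmetric])
      then show ?thesis using h f_in H by (simp add: subgroup.m_inv_closed)
    qed
    then show ?thesis
      using adjacency_op_pair_graph_out[OF H S, of y f] y False f_out by simp
  qed
  ultimately show ?thesis using s\<^sub>0G by (auto simp: graph_eigenfunction_def)
qed

text \<open>Completing the square treats both signs at once; \<open>0 \<le> c\<close> keeps the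
  radicand nonnegative, so squaring removes the root.\<close>

lemma quadratic_root:
  fixes b c \<mu> :: real
  assumes "0 \<le> c"
    and "\<mu> = (b + sqrt (b\<^sup>2 + 4 * c)) / 2 \<or> \<mu> = (b - sqrt (b\<^sup>2 + 4 * c)) / 2"
  shows "\<mu>\<^sup>2 = b * \<mu> + c"
proof -
  have "2 * \<mu> - b = sqrt (b\<^sup>2 + 4 * c) \<or> 2 * \<mu> - b = - sqrt (b\<^sup>2 + 4 * c)"
    using assms(2) by argo
  then have "(2 * \<mu> - b)\<^sup>2 = (sqrt (b\<^sup>2 + 4 * c))\<^sup>2" by (simp only: power2_eq_iff)
  also have "\<dots> = b\<^sup>2 + 4 * c" using assms(1) by simp
  finally show ?thesis by (simp add: power2_eq_square algebra_simps)
qed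

theorem theorem3p11:
  fixes G (structure) and H S :: "'a set" and x :: "nat \<Rightarrow> 'a" and k :: nat
    and \<mu>\<^sub>p \<mu>\<^sub>m :: real
  assumes "group G" and "finite (carrier G)"
    and "subgroup H G" and "card (rcosets H) = k + 1" and "k \<ge> 1"
    and "S \<subseteq> carrier G" and "S \<noteq> {}"
    and "set_inv (S \<inter> H) = S \<inter> H"
    and "card (S - H) \<noteq> 0"
    and "x 0 = \<one>" and "x ` {0..k} \<subseteq> carrier G"
    and "bij_betw (\<lambda>i. H #> x i) {0..k} (rcosets H)"
    and "\<mu>\<^sub>p = (real (card (S \<inter> H)) + sqrt (real (card (S \<inter> H)) ^ 2
            + 4 * (\<Sum>i=1..k. real (card (S \<inter> (H #> x i))) ^ 2))) / 2"
    and "\<mu>\<^sub>m = (real (card (S \<inter> H)) - sqrt (real (card (S \<inter> H)) ^ 2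
            + 4 * (\<Sum>i=1..k. real (card (S \<inter> (H #> x i))) ^ 2))) / 2"
  shows "\<forall>\<mu>\<in>{\<mu>\<^sub>p, \<mu>\<^sub>m}.
    graph_eigenvalue (carrier G) (pair_graph_edges G H S) (complex_of_real \<mu>) \<and>
    (\<forall>f :: 'a \<Rightarrow> complex.
       (\<forall>y\<in>H. f y = complex_of_real \<mu>) \<and>
       (\<forall>i\<in>{1..k}. \<forall>y \<in> H #> x i. f y = of_nat (card (S \<inter> (H #> x i)))) \<longrightarrow>
       graph_eigenfunction (carrier G) (pair_graph_edges G H S) (complex_of_real \<mu>) f)"
proof -
  interpret group G by fact
  note H = \<open>subgroup H G\<close> and S = \<open>S \<subseteq> carrier G\<close>
  have fin: "finite S" using S \<open>finite (carrier G)\<close> by (rule finite_subset)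
  have xG: "x i \<in> carrier G" if "i \<in> {0..k}" for i
    using that \<open>x ` {0..k} \<subseteq> carrier G\<close> by auto
  have inj: "inj_on (\<lambda>i. H #> x i) {0..k}" and onto: "(\<lambda>i. H #> x i) ` {0..k} = rcosets H"
    using \<open>bij_betw (\<lambda>i. H #> x i) {0..k} (rcosets H)\<close> by (auto simp: bij_betw_def)
  have x0: "H #> x 0 = H"
    using \<open>x 0 = \<one>\<close> coset_mult_one[OF subgroup.subset[OF H]] by simp
  have coset: "H #> y = H #> x i" if "i \<in> {0..k}" "y \<in> H #> x i" for i y
    using repr_independence[OF that(2) xG[OF that(1)] H] by simp
  \<comment> \<open>A common element would represent both cosets and make them equal, against
    injectivity of the enumeration.\<close>
  have disj: "(H #> x i) \<inter> (H #> x j) = {}" if "i \<in> {0..k}" "j \<in> {0..k}" "i \<noteq> j" for i j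
  proof -
    have "H #> x i \<noteq> H #> x j" using inj_onD[OF inj, of i j] that by auto
    then have "z \<notin> H #> x j" if "z \<in> H #> x i" for z
      using coset[OF \<open>i \<in> {0..k}\<close> that] coset[OF \<open>j \<in> {0..k}\<close>, of z] by metis
    then show ?thesis by blast
  qed
  \<comment> \<open>Index 0 stands for \<open>H\<close> itself, so the indices from 1 to
    \<open>k\<close> enumerate exactly the other cosets.\<close>
  have notH: "y \<notin> H" if "i \<in> {1..k}" "y \<in> H #> x i" for i y
    using disj[of i 0] x0 that by auto
  have ex: "\<exists>i\<in>{1..k}. y \<in> H #> x i" if y: "y \<in> carrier G" "y \<notin> H" for y
  proof -
    have "H #> y \<in> (\<lambda>i. H #> x i) ` {0..k}"
      unfolding onto using y subgroup.subset[OF H] by (simp add: rcosetsI)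
    then obtain i where i: "i \<in> {0..k}" "H #> y = H #> x i" by auto
    then have mem: "y \<in> H #> x i" using rcos_self[OF y(1) H] by simp
    then have "i \<noteq> 0" using x0 y(2) by (cases "i = 0") auto
    then show ?thesis using i mem by auto
  qed
  have SH: "S - H = (\<Union>i\<in>{1..k}. S \<inter> (H #> x i))"
  proof (intro equalityI subsetI)
    show "s \<in> (\<Union>i\<in>{1..k}. S \<inter> (H #> x i))" if "s \<in> S - H" for s
      using ex[of s] that S by auto
    show "s \<in> S - H" if "s \<in> (\<Union>i\<in>{1..k}. S \<inter> (H #> x i))" for s
      using that notH by blast
  qed
  \<comment> \<open>\<open>pair_graph_eigenfunctionI\<close> states the constant term without
    representatives, as a sum over \<open>S - H\<close>. Grouping that sum by cosets recovers the
    squares: each of the elements of \<open>S \<inter> (H #> x i)\<close> contributes the size of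
    this set.\<close>
  have "(\<Sum>s\<in>S - H. card (S \<inter> (H #> s)))
      = (\<Sum>i=1..k. \<Sum>s\<in>S \<inter> (H #> x i). card (S \<inter> (H #> s)))"
    unfolding SH
  proof (rule sum.UNION_disjoint)
    show "\<forall>i\<in>{1..k}. \<forall>j\<in>{1..k}. i \<noteq> j \<longrightarrow>
        S \<inter> (H #> x i) \<inter> (S \<inter> (H #> x j)) = {}"
    proof (intro ballI impI)
      fix i j assume "i \<in> {1..k}" "j \<in> {1..k}" "i \<noteq> j"
      then show "S \<inter> (H #> x i) \<inter> (S \<inter> (H #> x j)) = {}" using disj[of i j] by auto
    qed
  qed (use fin in auto)
  also have "\<dots> = (\<Sum>i=1..k. (card (S \<inter> (H #> x i)))\<^sup>2)"
  proof (rule sum.cong[OF refl])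
    fix i assume i: "i \<in> {1..k}"
    have "(\<Sum>s\<in>S \<inter> (H #> x i). card (S \<inter> (H #> s)))
        = (\<Sum>s\<in>S \<inter> (H #> x i). card (S \<inter> (H #> x i)))"
    proof (rule sum.cong[OF refl])
      fix s assume "s \<in> S \<inter> (H #> x i)"
      then have "H #> s = H #> x i" using coset[of i s] i by simp
      then show "card (S \<inter> (H #> s)) = card (S \<inter> (H #> x i))" by simp
    qed
    then show "(\<Sum>s\<in>S \<inter> (H #> x i). card (S \<inter> (H #> s))) = (card (S \<inter> (H #> x i)))\<^sup>2"
      by (simp add: power2_eq_square)
  qed
  finally have sum: "(\<Sum>s\<in>S - H. card (S \<inter> (H #> s))) = (\<Sum>i=1..k. (card (S \<inter> (H #> x i)))\<^sup>2)" .
  \<comment> \<open>Proved for an arbitrary \<open>f\<close> with the prescribed values; the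
    eigenvalue claim then needs only one such function.\<close>
  have eig: "graph_eigenfunction (carrier G) (pair_graph_edges G H S) (complex_of_real \<mu>) f"
    if \<mu>: "\<mu> \<in> {\<mu>\<^sub>p, \<mu>\<^sub>m}" and f_in: "\<forall>y\<in>H. f y = complex_of_real \<mu>"
      and f_out: "\<forall>i\<in>{1..k}. \<forall>y \<in> H #> x i. f y = of_nat (card (S \<inter> (H #> x i)))" for \<mu> f
  proof (rule pair_graph_eigenfunctionI[OF H S fin \<open>set_inv (S \<inter> H) = S \<inter> H\<close>])
    show "S - H \<noteq> {}" using \<open>card (S - H) \<noteq> 0\<close> by (metis card.empty)
    show "f y = complex_of_real \<mu>" if "y \<in> H" for y using f_in that by blast
    show "f y = of_nat (card (S \<inter> (H #> y)))" if y: "y \<in> carrier G - H" for y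
    proof -
      obtain i where i: "i \<in> {1..k}" "y \<in> H #> x i" using ex y by blast
      then have "H #> y = H #> x i" using coset[of i y] by simp
      then show ?thesis using bspec[OF bspec[OF f_out i(1)] i(2)] by simp
    qed
    have "\<mu>\<^sup>2 = real (card (S \<inter> H)) * \<mu> + (\<Sum>i=1..k. (real (card (S \<inter> (H #> x i))))\<^sup>2)"
      using \<mu> assms(13,14) by (intro quadratic_root sum_nonneg) auto
    \<comment> \<open>The quadratic equation holds over the reals, where the square root was taken,
      and is carried over to the complex numbers.\<close>
    from arg_cong[OF this, of complex_of_real]
    show "(complex_of_real \<mu>)\<^sup>2 = of_nat (card (S \<inter> H)) * complex_of_real \<mu>
        + of_nat (\<Sum>s\<in>S - H. card (S \<inter> (H #> s)))"
      unfolding sum by simp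
  qed
  show ?thesis
  proof (intro ballI conjI allI impI)
    fix \<mu> assume \<mu>: "\<mu> \<in> {\<mu>\<^sub>p, \<mu>\<^sub>m}"
    \<comment> \<open>Using \<open>H #> y\<close> instead of \<open>H #> x i\<close> avoids choosing
      an index for \<open>y\<close>; the two cosets coincide whenever \<open>y\<close> lies in the
      latter.\<close>
    define f where "f y = (if y \<in> H then complex_of_real \<mu> else of_nat (card (S \<inter> (H #> y))))"
      for y
    have f_in: "f y = complex_of_real \<mu>" if "y \<in> H" for y using that by (simp add: f_def)
    have f_out: "f y = of_nat (card (S \<inter> (H #> x i)))" if "i \<in> {1..k}" "y \<in> H #> x i" for i y
      using notH[OF that] coset[of i y] that by (simp add: f_def)
    have "graph_eigenfunction (carrier G) (pair_graph_edges G H S) (complex_of_real \<mu>) f"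
      by (intro eig[OF \<mu>] ballI f_in f_out)
    then show "graph_eigenvalue (carrier G) (pair_graph_edges G H S) (complex_of_real \<mu>)"
      by (auto simp: graph_eigenvalue_def)
  qed (use eig in blast)
qed

end
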